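(* Let $(\mathcal F,\partial,\int)$ be an ordinary shifted integro-differential algebra over an ordered field $K$. Then the distribution module $(\mathcal D\mathcal F,D,I)$ is a differential Rota-Baxter module over $\mathcal F$ that extends $(\mathcal P\mathcal F,\int)$ as a Rota-Baxter module (i.e. $\mathcal P\mathcal F\subset\mathcal D\mathcal F$ as $\mathcal F$-modules via $H_a\mapsto H_a$, and $I$ restricts to $\int$ on $\mathcal P\mathcal F$).
   Context: All algebras are commutative and unital; $[P,Q]=PQ-QP$. **Heaviside operator.** $H\colon K\to K$ is $H(a)=0$ for $a\le 0$ and $H(a)=1$ for $a>0$; $\bar H(a)=1-H(a)$; $a\sqcup b=\max(a,b)$. **Integro-differential algebra.** $(\mathcal F,\partial,\int)$ is a differential $K$-algebra with a $K$-linear map $\int$ such that $\partial\int=1$ and $f\int g=\int fg+\int(f'\int g)$. It is ordinary if $\ker\partial=K$; then $\mathsf e:=1-\int\partial$ is a $K$-algebra homomorphism $\mathcal F\to K$. It is shifted if there is a group homomorphism $S\colon(K,+)\to\operatorname{Aut}_K(\mathcal F)$, $c\mapsto S_c$, with $[S_c,\int]=\mathsf e_c\int$ and $[S_c,\partial]=0$, where $\mathsf e_c:=\mathsf e\circ S_c$. Set $\int_c:=(1-\mathsf e_c)\int$, $\int_c^d:=\mathsf e_d\int_c$. **Piecewise extension.** $\mathcal P\mathcal F$ is the free $\mathcal F$-module on $1$ and $H_a$ $(a\in K)$, an algebra via $H_aH_b=H_{a\sqcup b}$; $\bar H_a:=1-H_a$. Its Rota-Baxter operator is the $K$-linear extension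 of $\int$ on $\mathcal F$ with $\int fH_a=(\int_af)H_a+\bar H(a)\int_0^af$. **Distribution module.** Let $\mathcal F\{H_a\mid a\in K\}_1$ be the free $\mathcal F$-module on $1$ and all $H_a^{(k)}$ $(a\in K,k\ge 0)$, with derivation extending $\partial$, sending $H_a^{(k)}\mapsto H_a^{(k+1)}$ and obeying the Leibniz rule over $\mathcal F$. Put $\delta_a:=H_a'$ and let $Z$ be the differential $\mathcal F$-submodule generated by all $f\delta_a-\mathsf e_a(f)\delta_a$ $(f\in\mathcal F,a\in K)$. Then $\mathcal D\mathcal F:=\mathcal F\{H_a\mid a\in K\}_1/Z$ and $D$ is the map induced by the derivation. The map $I\colon\mathcal D\mathcal F\to\mathcal D\mathcal F$ is the $K$-linear map induced by setting $I=\int$ on $\mathcal P\mathcal F$ and $$I(f\delta_a)=\mathsf e_a(f)\big(H_a-\bar H(a)\big),\qquad I(f\delta_a^{(k)})=f\delta_a^{(k-1)}-I(f'\delta_a^{(k-1)})\quad(k>0)$$ for $f\in\mathcal F$, $a\in K$ (that $I$ is well defined on the quotient is part of the theorem). **Modules.** A Rota-Baxter module over $(\mathcal F,\int)$ is an $\mathcal F$-module $M$ with a $K$-linear map $I$ satisfying $(\int f)\cdot I\phi=I(f\,I\phi)+I((\int f)\phi)$ for $f\in\mathcal F,\phi\in M$. A differential Rota-Baxter module $(M,D,I)$ over $(\mathcal F,\partial,\int)$ is a Rota-Baxter module $(M,I)$ with a $K$-linear map $D\colon M\to M$ satisfying $D(f\phi)=(\partial f)\phi+f\,D\phi$ and $D\circ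 I=1_M$. *)

theory Defs
  imports
    "HOL-Library.Poly_Mapping"
    "HOL-Algebra.Algebraic_Closure_Type"
begin

section \<open>Shifted integro-differential algebras\<close>

text \<open>
  The ordered field \<open>K\<close> is the type \<open>'k\<close> and the commutative unital \<open>K\<close>-algebra \<open>F\<close> is the type
  \<open>'f\<close> with the scalar multiplication \<open>scale\<close>. An element \<open>c\<close> of \<open>K\<close> is identified with
  \<open>scale c 1\<close> in \<open>F\<close>; in particular the evaluations below, whose values lie in \<open>K\<close> when the algebra
  is ordinary, are typed as maps from \<open>F\<close> to \<open>F\<close>.
\<close>

definition evaluation :: "('f::comm_ring_1 \<Rightarrow> 'f) \<Rightarrow> ('f \<Rightarrow> 'f) \<Rightarrow> 'f \<Rightarrow> 'f" where
  "evaluation der integ f = f - integ (der f)"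

locale integro_differential_algebra = vector_space scale
  for scale :: "'k::field \<Rightarrow> 'f::comm_ring_1 \<Rightarrow> 'f" +
  fixes der :: "'f \<Rightarrow> 'f" and integ :: "'f \<Rightarrow> 'f"
  assumes scale_mult_left: "scale c (f * g) = scale c f * g"
    and linear_der: "Vector_Spaces.linear scale scale der"
    and der_mult: "der (f * g) = der f * g + f * der g"
    and linear_integ: "Vector_Spaces.linear scale scale integ"
    and der_integ: "der (integ f) = f"
    and integ_by_parts: "f * integ g = integ (f * g) + integ (der f * integ g)"

locale ordinary_integro_differential_algebra = integro_differential_algebra +
  assumes ker_der: "{f. der f = 0} = range (\<lambda>c. scale c 1)"

locale shifted_integro_differential_algebra = integro_differential_algebra scale der integ
  for scale :: "'k::field \<Rightarrow> 'f::comm_ring_1 \<Rightarrow> 'f" and der integ +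
  fixes S :: "'k \<Rightarrow> 'f \<Rightarrow> 'f"
  assumes bij_S: "bij (S c)"
    and linear_S: "Vector_Spaces.linear scale scale (S c)"
    and S_mult: "S c (f * g) = S c f * S c g"
    and S_one: "S c 1 = 1"
    and S_add: "S (c + d) = S c \<circ> S d"
    and S_integ: "S c (integ f) - integ (S c f) = evaluation der integ (S c (integ f))"
    and S_der: "S c (der f) - der (S c f) = 0"

definition eval_at ::
  "('f::comm_ring_1 \<Rightarrow> 'f) \<Rightarrow> ('f \<Rightarrow> 'f) \<Rightarrow> ('k \<Rightarrow> 'f \<Rightarrow> 'f) \<Rightarrow> 'k \<Rightarrow> 'f \<Rightarrow> 'f" where
  "eval_at der integ S c f = evaluation der integ (S c f)"

definition integ_from ::
  "('f::comm_ring_1 \<Rightarrow> 'f) \<Rightarrow> ('f \<Rightarrow> 'f) \<Rightarrow> ('k \<Rightarrow> 'f \<Rightarrow> 'f) \<Rightarrow> 'k \<Rightarrow> 'f \<Rightarrow> 'f" where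
  "integ_from der integ S c f = integ f - eval_at der integ S c (integ f)"

definition integ_between ::
  "('f::comm_ring_1 \<Rightarrow> 'f) \<Rightarrow> ('f \<Rightarrow> 'f) \<Rightarrow> ('k \<Rightarrow> 'f \<Rightarrow> 'f) \<Rightarrow> 'k \<Rightarrow> 'k \<Rightarrow> 'f \<Rightarrow> 'f" where
  "integ_between der integ S c d f = eval_at der integ S d (integ_from der integ S c f)"

definition heaviside :: "'k::linordered_field \<Rightarrow> 'k" where
  "heaviside a = (if a \<le> 0 then 0 else 1)"

definition heaviside_bar :: "'k::linordered_field \<Rightarrow> 'k" where
  "heaviside_bar a = 1 - heaviside a"


section \<open>Modules\<close>

text \<open>
  The module record extends the ring record, so it has multiplicative fields; the module axioms
  do not refer to them and they are left unspecified. The ring of scalars is the type \<open>'f\<close>, seen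
  as the ring record \<^const>\<open>ring_of_type_algebra\<close>.
\<close>

definition free_module :: "('f::comm_ring_1, 'b \<Rightarrow>\<^sub>0 'f) module" where
  "free_module = \<lparr>carrier = UNIV, monoid.mult = undefined, one = undefined, zero = 0, add = (+),
     module.smult = (\<lambda>f. Poly_Mapping.map ((*) f))\<rparr>"

text \<open>For \<open>g b\<close> additive, the additive map on the free module with values \<open>g b f\<close> on \<open>f \<cdot> b\<close>.\<close>

definition free_extend :: "('b \<Rightarrow> 'f \<Rightarrow> 'm) \<Rightarrow> ('b \<Rightarrow>\<^sub>0 'f::zero) \<Rightarrow> 'm::comm_monoid_add" where
  "free_extend g p = (\<Sum>b\<in>Poly_Mapping.keys p. g b (Poly_Mapping.lookup p b))"

definition quot_module :: "('r, 'm) module \<Rightarrow> 'm set \<Rightarrow> ('r, 'm set) module" where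
  "quot_module M N = \<lparr>carrier = a_rcosets\<^bsub>M\<^esub> N, monoid.mult = undefined, one = undefined, zero = N,
     add = set_add M, module.smult = (\<lambda>r C. \<Union>x\<in>C. N +>\<^bsub>M\<^esub> (r \<odot>\<^bsub>M\<^esub> x))\<rparr>"

text \<open>
  The operator induced on the quotient by \<open>T\<close>. Its values are cosets only if \<open>T\<close> is compatible
  with congruence modulo \<open>N\<close>.
\<close>

definition quot_map :: "('r, 'm) module \<Rightarrow> 'm set \<Rightarrow> ('m \<Rightarrow> 'm) \<Rightarrow> 'm set \<Rightarrow> 'm set" where
  "quot_map M N T C = (\<Union>x\<in>C. N +>\<^bsub>M\<^esub> T x)"

text \<open>
  Linearity over a set \<open>A\<close> of scalars: \<open>A = UNIV\<close> gives \<open>F\<close>-linear maps and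
  \<open>A = range (\<lambda>c. scale c 1)\<close> gives \<open>K\<close>-linear maps.
\<close>

definition linear_over ::
  "'f set \<Rightarrow> ('f, 'm) module \<Rightarrow> ('f, 'n) module \<Rightarrow> ('m \<Rightarrow> 'n) \<Rightarrow> bool" where
  "linear_over A M N T \<longleftrightarrow>
     T \<in> carrier M \<rightarrow> carrier N \<and>
     (\<forall>\<phi>\<in>carrier M. \<forall>\<psi>\<in>carrier M. T (\<phi> \<oplus>\<^bsub>M\<^esub> \<psi>) = T \<phi> \<oplus>\<^bsub>N\<^esub> T \<psi>) \<and>
     (\<forall>f\<in>A. \<forall>\<phi>\<in>carrier M. T (f \<odot>\<^bsub>M\<^esub> \<phi>) = f \<odot>\<^bsub>N\<^esub> T \<phi>)"

locale rota_baxter_module = module "ring_of_type_algebra :: 'f ring" M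
  for scale :: "'k::field \<Rightarrow> 'f::comm_ring_1 \<Rightarrow> 'f" and integ :: "'f \<Rightarrow> 'f"
    and M :: "('f, 'm) module" and I :: "'m \<Rightarrow> 'm" +
  assumes linear_I: "linear_over (range (\<lambda>c. scale c 1)) M M I"
    and rota_baxter: "\<phi> \<in> carrier M \<Longrightarrow>
      integ f \<odot>\<^bsub>M\<^esub> I \<phi> = I (f \<odot>\<^bsub>M\<^esub> I \<phi>) \<oplus>\<^bsub>M\<^esub> I (integ f \<odot>\<^bsub>M\<^esub> \<phi>)"

locale differential_rota_baxter_module = rota_baxter_module scale integ M I
  for scale :: "'k::field \<Rightarrow> 'f::comm_ring_1 \<Rightarrow> 'f" and der :: "'f \<Rightarrow> 'f" and integ :: "'f \<Rightarrow> 'f"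
    and M :: "('f, 'm) module" and D :: "'m \<Rightarrow> 'm" and I :: "'m \<Rightarrow> 'm" +
  assumes linear_D: "linear_over (range (\<lambda>c. scale c 1)) M M D"
    and leibniz: "\<phi> \<in> carrier M \<Longrightarrow> D (f \<odot>\<^bsub>M\<^esub> \<phi>) = (der f \<odot>\<^bsub>M\<^esub> \<phi>) \<oplus>\<^bsub>M\<^esub> (f \<odot>\<^bsub>M\<^esub> D \<phi>)"
    and D_I: "\<phi> \<in> carrier M \<Longrightarrow> D (I \<phi>) = \<phi>"

text \<open>\<open>(N, J)\<close> extends \<open>(M, I)\<close> along the embedding \<open>\<iota>\<close>.\<close>

locale rota_baxter_extension =
  M: rota_baxter_module scale integ M I + N: rota_baxter_module scale integ N J
  for scale :: "'k::field \<Rightarrow> 'f::comm_ring_1 \<Rightarrow> 'f" and integ :: "'f \<Rightarrow> 'f"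
    and M :: "('f, 'm) module" and I :: "'m \<Rightarrow> 'm"
    and N :: "('f, 'n) module" and J :: "'n \<Rightarrow> 'n"
    and \<iota> :: "'m \<Rightarrow> 'n" +
  assumes linear_embedding: "linear_over UNIV M N \<iota>"
    and inj_embedding: "inj_on \<iota> (carrier M)"
    and embedding_commutes: "\<phi> \<in> carrier M \<Longrightarrow> J (\<iota> \<phi>) = \<iota> (I \<phi>)"


section \<open>The piecewise extension\<close>

text \<open>The module basis: \<open>PUnit\<close> is \<open>1\<close> and \<open>PH a\<close> is \<open>H\<^sub>a\<close>.\<close>

datatype 'k pw_gen = PUnit | PH 'k

abbreviation pw_module :: "('f::comm_ring_1, 'k pw_gen \<Rightarrow>\<^sub>0 'f) module" where
  "pw_module \<equiv> free_module"

definition pw_integ ::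
  "('k::linordered_field \<Rightarrow> 'f::comm_ring_1 \<Rightarrow> 'f) \<Rightarrow> ('f \<Rightarrow> 'f) \<Rightarrow> ('f \<Rightarrow> 'f) \<Rightarrow> ('k \<Rightarrow> 'f \<Rightarrow> 'f) \<Rightarrow>
   ('k pw_gen \<Rightarrow>\<^sub>0 'f) \<Rightarrow> ('k pw_gen \<Rightarrow>\<^sub>0 'f)" where
  "pw_integ scale der integ S = free_extend (\<lambda>b f. case b of
       PUnit \<Rightarrow> Poly_Mapping.single PUnit (integ f)
     | PH a \<Rightarrow> Poly_Mapping.single (PH a) (integ_from der integ S a f) +
         Poly_Mapping.single PUnit (scale (heaviside_bar a) (integ_between der integ S 0 a f)))"


section \<open>The distribution module\<close>

text \<open>
  \<open>DUnit\<close> is \<open>1\<close> and \<open>DH a k\<close> is the \<open>k\<close>-th derivative of \<open>H\<^sub>a\<close>. Hence the \<open>k\<close>-th derivative of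
  \<open>\<delta>\<^sub>a\<close> is \<open>DH a (Suc k)\<close>.
\<close>

datatype 'k dist_gen = DUnit | DH 'k nat

definition delta :: "'k \<Rightarrow> ('k dist_gen \<Rightarrow>\<^sub>0 'f::comm_ring_1)" where
  "delta a = Poly_Mapping.single (DH a 1) 1"

definition free_der ::
  "('f::comm_ring_1 \<Rightarrow> 'f) \<Rightarrow> ('k dist_gen \<Rightarrow>\<^sub>0 'f) \<Rightarrow> ('k dist_gen \<Rightarrow>\<^sub>0 'f)" where
  "free_der der = free_extend (\<lambda>b f. case b of
       DUnit \<Rightarrow> Poly_Mapping.single DUnit (der f)
     | DH a k \<Rightarrow> Poly_Mapping.single (DH a k) (der f) + Poly_Mapping.single (DH a (Suc k)) f)"

definition dist_relations ::
  "('f::comm_ring_1 \<Rightarrow> 'f) \<Rightarrow> ('f \<Rightarrow> 'f) \<Rightarrow> ('k \<Rightarrow> 'f \<Rightarrow> 'f) \<Rightarrow> ('k dist_gen \<Rightarrow>\<^sub>0 'f) set" where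
  "dist_relations der integ S =
     (\<lambda>N. submodule N ring_of_type_algebra free_module \<and> free_der der ` N \<subseteq> N) hull
       (\<Union>f a. {f \<odot>\<^bsub>free_module\<^esub> delta a - eval_at der integ S a f \<odot>\<^bsub>free_module\<^esub> delta a})"

definition dist_module ::
  "('f::comm_ring_1 \<Rightarrow> 'f) \<Rightarrow> ('f \<Rightarrow> 'f) \<Rightarrow> ('k \<Rightarrow> 'f \<Rightarrow> 'f) \<Rightarrow>
   ('f, ('k dist_gen \<Rightarrow>\<^sub>0 'f) set) module" where
  "dist_module der integ S = quot_module free_module (dist_relations der integ S)"

definition dist_coset ::
  "('f::comm_ring_1 \<Rightarrow> 'f) \<Rightarrow> ('f \<Rightarrow> 'f) \<Rightarrow> ('k \<Rightarrow> 'f \<Rightarrow> 'f) \<Rightarrow>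
   ('k dist_gen \<Rightarrow>\<^sub>0 'f) \<Rightarrow> ('k dist_gen \<Rightarrow>\<^sub>0 'f) set" where
  "dist_coset der integ S \<phi> = dist_relations der integ S +>\<^bsub>free_module\<^esub> \<phi>"

definition dist_der ::
  "('f::comm_ring_1 \<Rightarrow> 'f) \<Rightarrow> ('f \<Rightarrow> 'f) \<Rightarrow> ('k \<Rightarrow> 'f \<Rightarrow> 'f) \<Rightarrow>
   ('k dist_gen \<Rightarrow>\<^sub>0 'f) set \<Rightarrow> ('k dist_gen \<Rightarrow>\<^sub>0 'f) set" where
  "dist_der der integ S = quot_map free_module (dist_relations der integ S) (free_der der)"

definition pw_to_free :: "('k pw_gen \<Rightarrow>\<^sub>0 'f::comm_ring_1) \<Rightarrow> ('k dist_gen \<Rightarrow>\<^sub>0 'f)" where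
  "pw_to_free = free_extend (\<lambda>b f. case b of
       PUnit \<Rightarrow> Poly_Mapping.single DUnit f
     | PH a \<Rightarrow> Poly_Mapping.single (DH a 0) f)"

text \<open>\<open>delta_integ scale der integ S a k f\<close> is the integral of \<open>f\<close> times the \<open>k\<close>-th derivative of \<open>\<delta>\<^sub>a\<close>.\<close>

primrec delta_integ ::
  "('k::linordered_field \<Rightarrow> 'f::comm_ring_1 \<Rightarrow> 'f) \<Rightarrow> ('f \<Rightarrow> 'f) \<Rightarrow> ('f \<Rightarrow> 'f) \<Rightarrow> ('k \<Rightarrow> 'f \<Rightarrow> 'f) \<Rightarrow>
   'k \<Rightarrow> nat \<Rightarrow> 'f \<Rightarrow> ('k dist_gen \<Rightarrow>\<^sub>0 'f)" where
  "delta_integ scale der integ S a 0 f =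
     eval_at der integ S a f \<odot>\<^bsub>free_module\<^esub>
       (Poly_Mapping.single (DH a 0) 1 - Poly_Mapping.single DUnit (scale (heaviside_bar a) 1))"
| "delta_integ scale der integ S a (Suc k) f =
     Poly_Mapping.single (DH a (Suc k)) f - delta_integ scale der integ S a k (der f)"

definition free_integ ::
  "('k::linordered_field \<Rightarrow> 'f::comm_ring_1 \<Rightarrow> 'f) \<Rightarrow> ('f \<Rightarrow> 'f) \<Rightarrow> ('f \<Rightarrow> 'f) \<Rightarrow> ('k \<Rightarrow> 'f \<Rightarrow> 'f) \<Rightarrow>
   ('k dist_gen \<Rightarrow>\<^sub>0 'f) \<Rightarrow> ('k dist_gen \<Rightarrow>\<^sub>0 'f)" where
  "free_integ scale der integ S = free_extend (\<lambda>b f. case b of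
       DUnit \<Rightarrow> pw_to_free (pw_integ scale der integ S (Poly_Mapping.single PUnit f))
     | DH a n \<Rightarrow> (case n of
           0 \<Rightarrow> pw_to_free (pw_integ scale der integ S (Poly_Mapping.single (PH a) f))
         | Suc k \<Rightarrow> delta_integ scale der integ S a k f))"

definition dist_integ ::
  "('k::linordered_field \<Rightarrow> 'f::comm_ring_1 \<Rightarrow> 'f) \<Rightarrow> ('f \<Rightarrow> 'f) \<Rightarrow> ('f \<Rightarrow> 'f) \<Rightarrow> ('k \<Rightarrow> 'f \<Rightarrow> 'f) \<Rightarrow>
   ('k dist_gen \<Rightarrow>\<^sub>0 'f) set \<Rightarrow> ('k dist_gen \<Rightarrow>\<^sub>0 'f) set" where
  "dist_integ scale der integ S =
     quot_map free_module (dist_relations der integ S) (free_integ scale der integ S)"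

definition pw_to_dist ::
  "('f::comm_ring_1 \<Rightarrow> 'f) \<Rightarrow> ('f \<Rightarrow> 'f) \<Rightarrow> ('k \<Rightarrow> 'f \<Rightarrow> 'f) \<Rightarrow>
   ('k pw_gen \<Rightarrow>\<^sub>0 'f) \<Rightarrow> ('k dist_gen \<Rightarrow>\<^sub>0 'f) set" where
  "pw_to_dist der integ S \<phi> = dist_coset der integ S (pw_to_free \<phi>)"

end

theory Submission
  imports Defs
begin

text \<open>
  Write \<open>e\<^sub>a\<close> for the evaluations, \<open>Z\<close> for the relations, and \<open>D\<close>, \<open>I\<close> for the operators on the
  free module that induce \<open>D\<close> and \<open>I\<close> on the quotient. Everything is proved on the free module, as an
  equation or as a congruence modulo \<open>Z\<close>, and passes to the quotient by general facts on cosets.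

  Evaluations are characters with values in the constants, because \<open>f = e(f) + \<integral>f'\<close> and \<open>e\<close> kills
  every multiple of an integral. The theorem then rests on one computation, \<open>I_D\<close>: the defect
  \<open>p - I (D p)\<close> is \<open>0\<close> on multiples of \<open>\<delta>\<^sub>a\<close> and its derivatives, and on \<open>f\<close> and \<open>f H\<^sub>a\<close> it is
  \<open>e\<^sub>0(f)\<close> times a constant. It thus measures the value of \<open>p\<close> at \<open>0\<close>. This computation is exact,
  and it is used twice.

  \<^item> \<open>I\<close> is well defined (\<open>I_smult_Z\<close>). On combinations of the \<open>\<delta>\<^sub>a\<close> and their derivatives \<open>I \<circ> D = 1\<close>,
    so \<open>I (g D p) = I (D (g p)) - I (g' p) = g p - I (g' p)\<close>. This shows that the property
    that \<open>I (g p) \<in> Z\<close> for all \<open>g\<close> passes from \<open>p \<in> Z\<close> to \<open>D p\<close>; it holds for the generators since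
    \<open>e\<^sub>a\<close> is multiplicative.

  \<^item> The Rota-Baxter law holds (\<open>rota_baxter_mod_Z\<close>). All coefficients of \<open>\<integral>f \<cdot> I p\<close> are multiples of
    \<open>\<integral>f\<close>, hence are killed by \<open>e\<^sub>0\<close>, so \<open>\<integral>f \<cdot> I p = I (D (\<integral>f \<cdot> I p))\<close>. The Leibniz rule and
    \<open>D (I p) \<equiv> p\<close> (\<open>D_I\<close>) turn the right-hand side into \<open>I (f I p) + I (\<integral>f p)\<close> modulo \<open>Z\<close>.

  The elements of \<open>Z\<close> involve only the \<open>\<delta>\<^sub>a\<close> and their derivatives, so the piecewise extension meets \<open>Z\<close>
  trivially. It therefore embeds into the distribution module and inherits the Rota-Baxter law from it.
\<close>

section \<open>Quotients of modules\<close>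

locale module_with_submodule = module R M + submodule N R M
  for R :: "('r, 's) ring_scheme" (structure) and M :: "('r, 'm) module" and N :: "'m set"
begin

sublocale abelian_subgroup N M
  by (rule abelian_subgroupI3) (auto intro: additive_subgroup.intro subgroup_axioms abelian_group_axioms)

lemma carrier_quot_module: "carrier (quot_module M N) = (\<lambda>x. N +>\<^bsub>M\<^esub> x) ` carrier M"
  by (auto simp: quot_module_def A_RCOSETS_def')

lemma add_quot_module:
  "x \<in> carrier M \<Longrightarrow> y \<in> carrier M \<Longrightarrow>
    (N +>\<^bsub>M\<^esub> x) \<oplus>\<^bsub>quot_module M N\<^esub> (N +>\<^bsub>M\<^esub> y) = N +>\<^bsub>M\<^esub> (x \<oplus>\<^bsub>M\<^esub> y)"
  by (simp add: quot_module_def a_rcos_sum)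

lemma zero_quot_module: "\<zero>\<^bsub>quot_module M N\<^esub> = N +>\<^bsub>M\<^esub> \<zero>\<^bsub>M\<^esub>"
  by (simp add: quot_module_def a_subset)

lemma coset_eq_iff:
  assumes "x \<in> carrier M" "y \<in> carrier M"
  shows "N +>\<^bsub>M\<^esub> x = N +>\<^bsub>M\<^esub> y \<longleftrightarrow> x \<ominus>\<^bsub>M\<^esub> y \<in> N"
  using assms by (metis a_rcos_module a_rcos_self a_repr_independence' M.minus_eq)

lemma quot_map_coset:
  assumes T: "\<And>x y. x \<in> carrier M \<Longrightarrow> y \<in> carrier M \<Longrightarrow> x \<ominus>\<^bsub>M\<^esub> y \<in> N \<Longrightarrow>
      T x \<in> carrier M \<and> T y \<in> carrier M \<and> T x \<ominus>\<^bsub>M\<^esub> T y \<in> N"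
    and x: "x \<in> carrier M"
  shows "quot_map M N T (N +>\<^bsub>M\<^esub> x) = N +>\<^bsub>M\<^esub> T x"
proof -
  have "N +>\<^bsub>M\<^esub> T y = N +>\<^bsub>M\<^esub> T x" if y: "y \<in> N +>\<^bsub>M\<^esub> x" for y
  proof -
    have yc: "y \<in> carrier M" using y x a_r_coset_subset_G a_subset by blast
    then have "y \<ominus>\<^bsub>M\<^esub> x \<in> N" using y x by (simp add: a_rcos_module M.minus_eq)
    then show ?thesis using T[OF yc x] coset_eq_iff by blast
  qed
  moreover have "x \<in> N +>\<^bsub>M\<^esub> x" using x by (rule a_rcos_self)
  ultimately show ?thesis unfolding quot_map_def by blast
qed

lemma smult_quot_module:
  assumes "r \<in> carrier R" "x \<in> carrier M"
  shows "r \<odot>\<^bsub>quot_module M N\<^esub> (N +>\<^bsub>M\<^esub> x) = N +>\<^bsub>M\<^esub> (r \<odot>\<^bsub>M\<^esub> x)"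
proof -
  have "quot_map M N (\<lambda>x. r \<odot>\<^bsub>M\<^esub> x) (N +>\<^bsub>M\<^esub> x) = N +>\<^bsub>M\<^esub> (r \<odot>\<^bsub>M\<^esub> x)"
  proof (rule quot_map_coset)
    fix x y assume xy: "x \<in> carrier M" "y \<in> carrier M" "x \<ominus>\<^bsub>M\<^esub> y \<in> N"
    then have "r \<odot>\<^bsub>M\<^esub> x \<ominus>\<^bsub>M\<^esub> r \<odot>\<^bsub>M\<^esub> y = r \<odot>\<^bsub>M\<^esub> (x \<ominus>\<^bsub>M\<^esub> y)"
      using assms(1) by (simp add: M.minus_eq smult_r_distr smult_r_minus)
    then show "r \<odot>\<^bsub>M\<^esub> x \<in> carrier M \<and> r \<odot>\<^bsub>M\<^esub> y \<in> carrier M \<and> r \<odot>\<^bsub>M\<^esub> x \<ominus>\<^bsub>M\<^esub> r \<odot>\<^bsub>M\<^esub> y \<in> N"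
      using xy assms(1) submodule_axioms by (simp add: submodule.smult_closed)
  qed (rule assms)
  then show ?thesis by (simp add: quot_map_def quot_module_def)
qed

lemma module_quot_module: "module R (quot_module M N)"
proof (rule moduleI)
  show "cring R" ..
  show "abelian_group (quot_module M N)"
  proof (rule abelian_groupI)
    fix C assume "C \<in> carrier (quot_module M N)"
    then obtain x where x: "x \<in> carrier M" "C = N +>\<^bsub>M\<^esub> x" by (auto simp: carrier_quot_module)
    then show "\<exists>B\<in>carrier (quot_module M N). B \<oplus>\<^bsub>quot_module M N\<^esub> C = \<zero>\<^bsub>quot_module M N\<^esub>"
      by (intro bexI[of _ "N +>\<^bsub>M\<^esub> (\<ominus>\<^bsub>M\<^esub> x)"])
        (auto simp: carrier_quot_module add_quot_module zero_quot_module M.l_neg)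
  qed (auto simp: carrier_quot_module add_quot_module zero_quot_module M.a_ac)
qed (auto simp: carrier_quot_module add_quot_module smult_quot_module smult_l_distr smult_r_distr
    smult_assoc1)

text \<open>
  A linear operator that preserves the submodule acts on cosets through representatives. Linearity over
  a part of the ring suffices, which covers derivations and integrals.
\<close>
lemma linear_over_quot_map:
  assumes T: "linear_over A M M T" and A: "A \<subseteq> carrier R" and N: "T ` N \<subseteq> N"
  shows quot_map_linear_coset: "x \<in> carrier M \<Longrightarrow> quot_map M N T (N +>\<^bsub>M\<^esub> x) = N +>\<^bsub>M\<^esub> T x"
    and "linear_over A (quot_module M N) (quot_module M N) (quot_map M N T)"
proof -
  have closed: "T x \<in> carrier M" if "x \<in> carrier M" for x
    using T that by (auto simp: linear_over_def)
  have add: "T (x \<oplus>\<^bsub>M\<^esub> y) = T x \<oplus>\<^bsub>M\<^esub> T y" if "x \<in> carrier M" "y \<in> carrier M" for x y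
    using T that by (auto simp: linear_over_def)
  have diff: "T (x \<ominus>\<^bsub>M\<^esub> y) = T x \<ominus>\<^bsub>M\<^esub> T y" if "x \<in> carrier M" "y \<in> carrier M" for x y
    using add[of "x \<ominus>\<^bsub>M\<^esub> y" y] that closed
    by (metis M.add.inv_closed M.minus_closed M.minus_eq M.r_neg2 M.add.m_comm M.add.inv_solve_right)
  show coset: "quot_map M N T (N +>\<^bsub>M\<^esub> x) = N +>\<^bsub>M\<^esub> T x" if "x \<in> carrier M" for x
    using N closed that by (intro quot_map_coset) (auto simp flip: diff)
  show "linear_over A (quot_module M N) (quot_module M N) (quot_map M N T)"
    using T A unfolding linear_over_def
    by (auto simp: carrier_quot_module add_quot_module smult_quot_module coset closed subset_iff)
qed

end

section \<open>Free modules\<close>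

abbreviation fsmult :: "'f::comm_ring_1 \<Rightarrow> ('b \<Rightarrow>\<^sub>0 'f) \<Rightarrow> ('b \<Rightarrow>\<^sub>0 'f)" (infixr "\<cdot>" 75) where
  "f \<cdot> p \<equiv> f \<odot>\<^bsub>free_module\<^esub> p"

lemma free_module_simps [simp]:
  "carrier free_module = UNIV" "\<zero>\<^bsub>free_module\<^esub> = 0" "p \<oplus>\<^bsub>free_module\<^esub> q = p + q"
  by (simp_all add: free_module_def)

lemma ring_of_type_algebra_simps [simp]:
  "carrier ring_of_type_algebra = UNIV" "\<zero>\<^bsub>ring_of_type_algebra\<^esub> = 0"
  "f \<oplus>\<^bsub>ring_of_type_algebra\<^esub> g = f + g" "f \<otimes>\<^bsub>ring_of_type_algebra\<^esub> g = f * g"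
  "\<one>\<^bsub>ring_of_type_algebra\<^esub> = 1"
  by (simp_all add: ring_of_type_algebra_def)

lemma lookup_smult [simp]: "Poly_Mapping.lookup (f \<cdot> p) b = f * Poly_Mapping.lookup p b"
  by (simp add: free_module_def Poly_Mapping.map.rep_eq when_def)

lemma smult_single [simp]: "f \<cdot> Poly_Mapping.single b g = Poly_Mapping.single b (f * g)"
  by (rule poly_mapping_eqI) (simp add: lookup_single when_def)

lemma smult_add_right: "f \<cdot> (p + q) = f \<cdot> p + f \<cdot> q"
  by (rule poly_mapping_eqI) (simp add: lookup_add distrib_left)

lemma smult_add_left: "(f + g) \<cdot> p = f \<cdot> p + g \<cdot> p"
  by (rule poly_mapping_eqI) (simp add: lookup_add distrib_right)

lemma smult_smult: "f \<cdot> (g \<cdot> p) = (f * g) \<cdot> p"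
  by (rule poly_mapping_eqI) (simp add: mult.assoc)

lemma module_free_module: "module ring_of_type_algebra (free_module :: ('f::comm_ring_1, 'b \<Rightarrow>\<^sub>0 'f) module)"
proof (rule moduleI)
  show "abelian_group (free_module :: ('f, 'b \<Rightarrow>\<^sub>0 'f) module)"
    by (rule abelian_groupI) (auto simp: add_ac intro: exI[of _ "- _"])
  show "\<one>\<^bsub>ring_of_type_algebra\<^esub> \<cdot> p = p" for p :: "'b \<Rightarrow>\<^sub>0 'f"
    by (rule poly_mapping_eqI) simp
qed (auto simp: smult_add_left smult_add_right smult_smult cring_from_type_algebra)

lemma minus_free_module [simp]:
  "\<ominus>\<^bsub>free_module\<^esub> p = - p" "p \<ominus>\<^bsub>free_module\<^esub> q = p - q"
  for p q :: "'b \<Rightarrow>\<^sub>0 'f::comm_ring_1"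
proof -
  interpret M: module ring_of_type_algebra "free_module :: ('f, 'b \<Rightarrow>\<^sub>0 'f) module"
    by (rule module_free_module)
  show inv: "\<ominus>\<^bsub>free_module\<^esub> p = - p" for p :: "'b \<Rightarrow>\<^sub>0 'f"
    by (rule M.minus_equality) simp_all
  show "p \<ominus>\<^bsub>free_module\<^esub> q = p - q"
    by (simp add: M.minus_eq inv)
qed

lemma free_extend_single [simp]: "g b 0 = 0 \<Longrightarrow> free_extend g (Poly_Mapping.single b f) = g b f"
  by (simp add: free_extend_def)

lemma free_extend_add:
  fixes g :: "'b \<Rightarrow> 'f::comm_ring_1 \<Rightarrow> 'm::ab_group_add"
  assumes "\<And>b. additive (g b)"
  shows "free_extend g (p + q) = free_extend g p + free_extend g q"
  unfolding free_extend_def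
  by (rule setsum_keys_plus_distrib) (simp_all add: additive.zero[OF assms] additive.add[OF assms])

text \<open>
  The freshness of the generator makes every coefficient of \<open>p\<close> a coefficient of the sum, so that
  conditions on coefficients survive the induction.
\<close>
lemma add_single_induct [case_names zero add_single]:
  assumes "P 0"
    and "\<And>p b f. b \<notin> Poly_Mapping.keys p \<Longrightarrow> P p \<Longrightarrow> P (p + Poly_Mapping.single b f)"
  shows "P p"
proof (induction p rule: update_induct)
  case (update p b f)
  have "Poly_Mapping.update b f p = p + Poly_Mapping.single b f"
    using update(1)
    by (intro poly_mapping_eqI) (auto simp: lookup_update lookup_add lookup_single in_keys_iff when_def)
  then show ?case using assms(2) update by simp
qed (rule assms)

lemma additive_eqI:
  fixes T T' :: "('b \<Rightarrow>\<^sub>0 'f::comm_ring_1) \<Rightarrow> 'm::ab_group_add"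
  assumes "additive T" "additive T'"
    and "\<And>b f. T (Poly_Mapping.single b f) = T' (Poly_Mapping.single b f)"
  shows "T p = T' p"
  by (induction p rule: add_single_induct)
    (auto simp: assms additive.add[OF assms(1)] additive.add[OF assms(2)]
      additive.zero[OF assms(1)] additive.zero[OF assms(2)])

text \<open>Negation is multiplication by \<open>- 1\<close>, so closure under it comes with the module structure.\<close>
lemma submodule_free_module_iff:
  "submodule N ring_of_type_algebra (free_module :: ('f::comm_ring_1, 'b \<Rightarrow>\<^sub>0 'f) module) \<longleftrightarrow>
    0 \<in> N \<and> (\<forall>p\<in>N. \<forall>q\<in>N. p + q \<in> N) \<and> (\<forall>f. \<forall>p\<in>N. f \<cdot> p \<in> N)"
  (is "?L \<longleftrightarrow> ?R")
proof
  interpret M: module ring_of_type_algebra "free_module :: ('f, 'b \<Rightarrow>\<^sub>0 'f) module"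
    by (rule module_free_module)
  show ?L if ?R
  proof (rule M.submoduleI)
    have "(- 1) \<cdot> p = - p" for p :: "'b \<Rightarrow>\<^sub>0 'f" by (rule poly_mapping_eqI) simp
    then show "\<ominus>\<^bsub>free_module\<^esub> p \<in> N" if "p \<in> N" for p
      using \<open>?R\<close> that by (metis minus_free_module(1))
  qed (use that in auto)
  show ?R if ?L
  proof -
    interpret submodule N ring_of_type_algebra "free_module :: ('f, 'b \<Rightarrow>\<^sub>0 'f) module" by fact
    show ?R using one_closed m_closed smult_closed by simp
  qed
qed

section \<open>Constants and evaluations\<close>

context integro_differential_algebra
begin

sublocale der: Vector_Spaces.linear scale scale der by (rule linear_der)
sublocale integ: Vector_Spaces.linear scale scale integ by (rule linear_integ)

lemma scale_eq_mult: "scale c f = scale c 1 * f"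
  using scale_mult_left[of c 1 f] by simp

lemma der_one [simp]: "der 1 = 0"
  using der_mult[of 1 1] by simp

lemma der_scale_one [simp]: "der (scale c 1) = 0"
  by (simp add: der.scale)

lemma evaluation_one [simp]: "evaluation der integ 1 = 1"
  by (simp add: evaluation_def integ.zero)

text \<open>Integration by parts says precisely that \<open>f\<integral>g\<close> is the integral of its own derivative.\<close>
lemma evaluation_mult_integ: "evaluation der integ (f * integ g) = 0"
  unfolding evaluation_def der_mult der_integ integ.add
  using integ_by_parts[of f g] by simp

text \<open>In an ordinary algebra this says that evaluations are scalars.\<close>
lemma der_evaluation: "der (evaluation der integ f) = 0"
  by (simp add: evaluation_def der.diff der_integ)

lemma linear_evaluation: "Vector_Spaces.linear scale scale (evaluation der integ)"
  by unfold_locales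
    (simp_all add: evaluation_def der.add der.scale integ.add integ.scale scale_right_diff_distrib)

end

locale ordinary_shifted_integro_differential_algebra =
  ordinary_integro_differential_algebra scale der integ +
  shifted_integro_differential_algebra scale der integ S
  for scale :: "'k::linordered_field \<Rightarrow> 'f::comm_ring_1 \<Rightarrow> 'f" and der integ S
begin

sublocale S: Vector_Spaces.linear scale scale "S c" for c by (rule linear_S)
sublocale evaluation: Vector_Spaces.linear scale scale "evaluation der integ"
  by (rule linear_evaluation)

abbreviation ev :: "'k \<Rightarrow> 'f \<Rightarrow> 'f" where
  "ev \<equiv> eval_at der integ S"

lemma const_obtain:
  assumes "der f = 0" obtains c where "f = scale c 1"
  using assms ker_der by auto

lemma integ_const_mult: "der c = 0 \<Longrightarrow> integ (c * f) = c * integ f"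
  by (metis const_obtain scale_eq_mult integ.scale)

lemma der_const_mult: "der c = 0 \<Longrightarrow> der (c * f) = c * der f"
  by (simp add: der_mult)

lemma evaluation_const_mult:
  "der c = 0 \<Longrightarrow> evaluation der integ (c * f) = c * evaluation der integ f"
  by (simp add: evaluation_def integ_const_mult der_const_mult algebra_simps)

text \<open>
  Splitting off the integral part of \<open>g\<close> replaces \<open>g\<close> by the constant \<open>e(g)\<close>, which can be pulled out.
\<close>
lemma evaluation_mult:
  "evaluation der integ (f * g) = evaluation der integ f * evaluation der integ g"
proof -
  let ?e = "evaluation der integ"
  have split: "f = ?e f + integ (der f)" for f by (simp add: evaluation_def)
  have "?e (f * g) = ?e (f * ?e g)"
    by (subst split[of g]) (simp only: distrib_left evaluation.add evaluation_mult_integ add_0_right)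
  also have "\<dots> = ?e g * ?e f"
    by (subst mult.commute) (rule evaluation_const_mult[OF der_evaluation])
  finally show ?thesis by (simp add: mult.commute)
qed

lemma S_zero: "S 0 f = f"
  using S_add[of 0 0] bij_S[of 0] by (metis add_0 bij_is_inj comp_eq_dest_lhs injD)

lemma der_ev [simp]: "der (ev a f) = 0"
  by (simp add: eval_at_def der_evaluation)

lemma ev_mult: "ev a (f * g) = ev a f * ev a g"
  by (simp add: eval_at_def S_mult evaluation_mult)

lemma ev_add: "ev a (f + g) = ev a f + ev a g"
  by (simp add: eval_at_def S.add evaluation.add)

lemma ev_diff: "ev a (f - g) = ev a f - ev a g"
  by (simp add: eval_at_def S.diff evaluation.diff)

lemma ev_zero [simp]: "ev a 0 = 0"
  by (simp add: eval_at_def S.zero evaluation.zero)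

lemma ev_const: "der c = 0 \<Longrightarrow> ev a c = c"
  by (metis const_obtain eval_at_def S.scale S_one evaluation.scale evaluation_one)

lemma ev_ev [simp]: "ev a (ev b f) = ev b f"
  by (simp add: ev_const)

lemma ev_0: "ev 0 f = f - integ (der f)"
  by (simp add: eval_at_def S_zero evaluation_def)

lemma ev_0_integ [simp]: "ev 0 (integ f) = 0"
  by (simp add: ev_0 der_integ)

section \<open>The operators on the free module\<close>

abbreviation D :: "('k dist_gen \<Rightarrow>\<^sub>0 'f) \<Rightarrow> ('k dist_gen \<Rightarrow>\<^sub>0 'f)" where
  "D \<equiv> free_der der"
abbreviation I :: "('k dist_gen \<Rightarrow>\<^sub>0 'f) \<Rightarrow> ('k dist_gen \<Rightarrow>\<^sub>0 'f)" where
  "I \<equiv> free_integ scale der integ S"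
abbreviation P :: "('k pw_gen \<Rightarrow>\<^sub>0 'f) \<Rightarrow> ('k pw_gen \<Rightarrow>\<^sub>0 'f)" where
  "P \<equiv> pw_integ scale der integ S"
abbreviation Z :: "('k dist_gen \<Rightarrow>\<^sub>0 'f) set" where
  "Z \<equiv> dist_relations der integ S"
abbreviation h :: "'k \<Rightarrow> 'f" where
  "h a \<equiv> scale (heaviside_bar a) 1"

lemma additive_D: "additive D"
  unfolding free_der_def
  by (intro additive.intro free_extend_add)
    (auto simp: der.add single_add split: dist_gen.split)

lemma D_single [simp]:
  "D (Poly_Mapping.single DUnit f) = Poly_Mapping.single DUnit (der f)"
  "D (Poly_Mapping.single (DH a k) f) =
     Poly_Mapping.single (DH a k) (der f) + Poly_Mapping.single (DH a (Suc k)) f"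
  by (simp_all add: free_der_def der.zero)

lemma additive_pw_to_free: "additive (pw_to_free :: ('k pw_gen \<Rightarrow>\<^sub>0 'f) \<Rightarrow> _)"
  unfolding pw_to_free_def
  by (intro additive.intro free_extend_add) (auto simp: single_add split: pw_gen.split)

lemma pw_to_free_single [simp]:
  "pw_to_free (Poly_Mapping.single PUnit f) = Poly_Mapping.single DUnit f"
  "pw_to_free (Poly_Mapping.single (PH a) f) = Poly_Mapping.single (DH a 0) f"
  by (simp_all add: pw_to_free_def)

lemma integ_from_eq: "integ_from der integ S a f = integ f - ev a (integ f)"
  by (simp add: integ_from_def)

text \<open>The integral starts at \<open>0\<close>, so its lower end contributes nothing.\<close>
lemma integ_between_0_eq: "integ_between der integ S 0 a f = ev a (integ f)"
  by (simp add: integ_between_def integ_from_def)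

lemma additive_P: "additive P"
  unfolding pw_integ_def
  by (intro additive.intro free_extend_add)
    (auto simp: single_add integ_from_eq integ_between_0_eq integ.add ev_add scale_right_distrib
      single_diff split: pw_gen.split)

lemma P_single [simp]:
  "P (Poly_Mapping.single PUnit f) = Poly_Mapping.single PUnit (integ f)"
  "P (Poly_Mapping.single (PH a) f) = Poly_Mapping.single (PH a) (integ f - ev a (integ f)) +
     Poly_Mapping.single PUnit (h a * ev a (integ f))"
  by (simp_all add: pw_integ_def integ.zero integ_from_eq integ_between_0_eq
      scale_eq_mult[of "heaviside_bar a" "ev a (integ f)"])

text \<open>The integral of \<open>f\<delta>\<^sub>a\<close> in coordinates, which is the form in which calculations use it.\<close>
lemma delta_integ_0:
  "delta_integ scale der integ S a 0 f =
     Poly_Mapping.single (DH a 0) (ev a f) - Poly_Mapping.single DUnit (h a * ev a f)"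
  by (rule poly_mapping_eqI) (simp add: lookup_minus lookup_single when_def right_diff_distrib)

declare delta_integ.simps(1) [simp del]

lemma additive_delta_integ: "additive (delta_integ scale der integ S a k)"
proof (induction k)
  case 0
  show ?case
    by (rule additive.intro) (simp only: delta_integ_0 ev_add single_add distrib_left, simp)
next
  case (Suc k)
  then show ?case by (auto intro!: additive.intro simp: single_add der.add additive.add[OF Suc])
qed

lemma additive_I: "additive I"
  unfolding free_integ_def
  by (intro additive.intro free_extend_add)
    (auto simp: additive.add[OF additive_P] additive.add[OF additive_pw_to_free] single_add
      additive.add[OF additive_delta_integ] split: dist_gen.split nat.split)

lemma I_single [simp]:
  "I (Poly_Mapping.single DUnit f) = Poly_Mapping.single DUnit (integ f)"
  "I (Poly_Mapping.single (DH a 0) f) =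
     Poly_Mapping.single (DH a 0) (integ f - ev a (integ f)) +
     Poly_Mapping.single DUnit (h a * ev a (integ f))"
  "I (Poly_Mapping.single (DH a (Suc k)) f) = delta_integ scale der integ S a k f"
  by (simp_all add: free_integ_def additive.zero[OF additive_P] additive.zero[OF additive_pw_to_free]
      additive.zero[OF additive_delta_integ] additive.add[OF additive_pw_to_free] integ.zero)

lemma D_smult: "D (f \<cdot> p) = der f \<cdot> p + f \<cdot> D p"
proof (rule additive_eqI[of "\<lambda>p. D (f \<cdot> p)" "\<lambda>p. der f \<cdot> p + f \<cdot> D p"])
  fix b g
  show "D (f \<cdot> Poly_Mapping.single b g) =
      der f \<cdot> Poly_Mapping.single b g + f \<cdot> D (Poly_Mapping.single b g)"
    by (cases b) (simp_all add: der_mult smult_add_right single_add add_ac)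
qed (auto intro!: additive.intro simp: smult_add_right additive.add[OF additive_D])

lemma delta_integ_const_mult:
  assumes "der c = 0"
  shows "delta_integ scale der integ S a k (c * f) = c \<cdot> delta_integ scale der integ S a k f"
proof (induction k arbitrary: f)
  case 0
  show ?case
    unfolding delta_integ_0
    by (rule poly_mapping_eqI)
      (simp add: assms ev_mult ev_const lookup_minus lookup_single when_def algebra_simps)
next
  case (Suc k)
  show ?case
    by (rule poly_mapping_eqI)
      (simp add: assms Suc der_const_mult lookup_minus lookup_single when_def right_diff_distrib)
qed

lemma I_const_smult:
  assumes "der c = 0"
  shows "I (c \<cdot> p) = c \<cdot> I p"
proof (rule additive_eqI[of "\<lambda>p. I (c \<cdot> p)" "\<lambda>p. c \<cdot> I p"])
  fix b g
  show "I (c \<cdot> Poly_Mapping.single b g) = c \<cdot> I (Poly_Mapping.single b g)"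
  proof (cases b)
    case (DH a k)
    then show ?thesis
      by (cases k)
        (simp_all add: assms delta_integ_const_mult integ_const_mult ev_mult ev_const
          smult_add_right algebra_simps)
  qed (simp add: assms integ_const_mult)
qed (auto intro!: additive.intro simp: smult_add_right additive.add[OF additive_I])

lemma P_const_smult:
  assumes "der c = 0"
  shows "P (c \<cdot> p) = c \<cdot> P p"
proof (rule additive_eqI[of "\<lambda>p. P (c \<cdot> p)" "\<lambda>p. c \<cdot> P p"])
  fix b g
  show "P (c \<cdot> Poly_Mapping.single b g) = c \<cdot> P (Poly_Mapping.single b g)"
    by (cases b)
      (simp_all add: assms integ_const_mult ev_mult ev_const smult_add_right algebra_simps)
qed (auto intro!: additive.intro simp: smult_add_right additive.add[OF additive_P])

text \<open>
  With \<open>c = h a\<close>, the case of \<open>f H\<^sub>a\<close> is the cancellation between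
  \<open>I (f' H\<^sub>a) = f H\<^sub>a - e\<^sub>a(f) (H\<^sub>a - c) - c e\<^sub>0(f)\<close> and \<open>I (f\<delta>\<^sub>a) = e\<^sub>a(f) (H\<^sub>a - c)\<close>. What remains
  is the multiple of \<open>e\<^sub>0(f)\<close>, which the hypothesis removes. For \<open>\<delta>\<^sub>a\<close> and its derivatives the
  recursion defining \<open>I\<close> is the statement.
\<close>
lemma I_D:
  assumes "\<And>b. (\<exists>a k. b = DH a (Suc k)) \<or> ev 0 (Poly_Mapping.lookup p b) = 0"
  shows "I (D p) = p"
  using assms
proof (induction p rule: add_single_induct)
  case zero
  show ?case by (simp add: additive.zero[OF additive_D] additive.zero[OF additive_I])
next
  case (add_single p b f)
  have p: "(\<exists>a k. b' = DH a (Suc k)) \<or> ev 0 (Poly_Mapping.lookup p b') = 0" for b'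
    using add_single(1) add_single.prems[of b']
    by (cases "b' = b") (auto simp: lookup_add lookup_single when_def in_keys_iff)
  \<comment> \<open>\<open>e\<^sub>0(f) = 0\<close> means that \<open>f\<close> is the integral of its derivative.\<close>
  have f: "(\<exists>a k. b = DH a (Suc k)) \<or> integ (der f) = f"
    using add_single(1) add_single.prems[of b] by (auto simp: lookup_add in_keys_iff ev_0)
  have "I (D (Poly_Mapping.single b f)) = Poly_Mapping.single b f"
  proof (cases b)
    case DUnit
    then show ?thesis using f by simp
  next
    case (DH a k)
    show ?thesis
    proof (cases k)
      case 0
      then show ?thesis
        using DH f by (simp add: additive.add[OF additive_I] delta_integ_0 single_diff)
    next
      case (Suc k')
      then show ?thesis using DH by (simp add: additive.add[OF additive_I])
    qed
  qed
  then show ?case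
    using add_single.IH[OF p] by (simp add: additive.add[OF additive_D] additive.add[OF additive_I])
qed

lemma I_pw_to_free: "I (pw_to_free p) = pw_to_free (P p)"
proof (rule additive_eqI[of "\<lambda>p. I (pw_to_free p)" "\<lambda>p. pw_to_free (P p)"])
  fix b g
  show "I (pw_to_free (Poly_Mapping.single b g)) = pw_to_free (P (Poly_Mapping.single b g))"
    by (cases b) (simp_all add: additive.add[OF additive_pw_to_free])
qed (auto intro!: additive.intro
    simp: additive.add[OF additive_P] additive.add[OF additive_I] additive.add[OF additive_pw_to_free])

lemma pw_to_free_smult: "pw_to_free (f \<cdot> p) = f \<cdot> (pw_to_free p :: 'k dist_gen \<Rightarrow>\<^sub>0 'f)"
proof (rule additive_eqI[of "\<lambda>p. pw_to_free (f \<cdot> p)" "\<lambda>p. f \<cdot> pw_to_free p"])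
  fix b :: "'k pw_gen" and g
  show "pw_to_free (f \<cdot> Poly_Mapping.single b g) = f \<cdot> pw_to_free (Poly_Mapping.single b g)"
    by (cases b) simp_all
qed (auto intro!: additive.intro simp: additive.add[OF additive_pw_to_free] smult_add_right)

lemma lookup_pw_to_free:
  fixes p :: "'k pw_gen \<Rightarrow>\<^sub>0 'f"
  shows "Poly_Mapping.lookup (pw_to_free p) DUnit = Poly_Mapping.lookup p PUnit"
    and "Poly_Mapping.lookup (pw_to_free p) (DH a 0) = Poly_Mapping.lookup p (PH a)"
proof -
  show "Poly_Mapping.lookup (pw_to_free p) DUnit = Poly_Mapping.lookup p PUnit"
  proof (rule additive_eqI[of "\<lambda>p. Poly_Mapping.lookup (pw_to_free p) DUnit"
        "\<lambda>p. Poly_Mapping.lookup p PUnit"])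
    fix b :: "'k pw_gen" and g :: 'f
    show "Poly_Mapping.lookup (pw_to_free (Poly_Mapping.single b g)) DUnit =
        Poly_Mapping.lookup (Poly_Mapping.single b g) PUnit"
      by (cases b) (simp_all add: lookup_single when_def)
  qed (auto intro!: additive.intro simp: lookup_add additive.add[OF additive_pw_to_free])
  show "Poly_Mapping.lookup (pw_to_free p) (DH a 0) = Poly_Mapping.lookup p (PH a)"
  proof (rule additive_eqI[of "\<lambda>p. Poly_Mapping.lookup (pw_to_free p) (DH a 0)"
        "\<lambda>p. Poly_Mapping.lookup p (PH a)"])
    fix b :: "'k pw_gen" and g :: 'f
    show "Poly_Mapping.lookup (pw_to_free (Poly_Mapping.single b g)) (DH a 0) =
        Poly_Mapping.lookup (Poly_Mapping.single b g) (PH a)"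
      by (cases b) (simp_all add: lookup_single when_def)
  qed (auto intro!: additive.intro simp: lookup_add additive.add[OF additive_pw_to_free])
qed

section \<open>The relations\<close>

text \<open>Combinations of the \<open>\<delta>\<^sub>a\<close> and their derivatives, that is, distributions of point support.\<close>
definition delta_supported :: "('k dist_gen \<Rightarrow>\<^sub>0 'f) \<Rightarrow> bool" where
  "delta_supported p \<longleftrightarrow>
     Poly_Mapping.lookup p DUnit = 0 \<and> (\<forall>a. Poly_Mapping.lookup p (DH a 0) = 0)"

lemma delta_supported_zero: "delta_supported 0"
  by (simp add: delta_supported_def)

lemma delta_supported_add: "delta_supported p \<Longrightarrow> delta_supported q \<Longrightarrow> delta_supported (p + q)"
  by (simp add: delta_supported_def lookup_add)

lemma delta_supported_smult: "delta_supported p \<Longrightarrow> delta_supported (f \<cdot> p)"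
  by (simp add: delta_supported_def)

lemma delta_supported_single: "delta_supported (Poly_Mapping.single (DH a (Suc k)) f)"
  by (simp add: delta_supported_def lookup_single)

text \<open>
  The new terms that \<open>D\<close> creates lie on derivatives of Heaviside generators; on the other generators
  it acts on coefficients.
\<close>
lemma lookup_D_generator:
  assumes "\<And>a k. b \<noteq> DH a (Suc k)"
  shows "Poly_Mapping.lookup (D p) b = der (Poly_Mapping.lookup p b)"
proof (rule additive_eqI[of "\<lambda>p. Poly_Mapping.lookup (D p) b" "\<lambda>p. der (Poly_Mapping.lookup p b)"])
  fix c g
  show "Poly_Mapping.lookup (D (Poly_Mapping.single c g)) b =
      der (Poly_Mapping.lookup (Poly_Mapping.single c g) b)"
    using assms by (cases c) (auto simp: lookup_add lookup_single when_def der.zero)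
qed (auto intro!: additive.intro simp: lookup_add additive.add[OF additive_D] der.add)

lemma delta_supported_D: "delta_supported p \<Longrightarrow> delta_supported (D p)"
  by (simp add: delta_supported_def lookup_D_generator der.zero)

lemma I_D_delta_supported:
  assumes "delta_supported p"
  shows "I (D p) = p"
proof (rule I_D)
  show "(\<exists>a k. b = DH a (Suc k)) \<or> ev 0 (Poly_Mapping.lookup p b) = 0" for b
  proof (cases b)
    case (DH a k)
    then show ?thesis using assms by (cases k) (simp_all add: delta_supported_def)
  qed (use assms in \<open>simp add: delta_supported_def\<close>)
qed

definition differential_submodule :: "('k dist_gen \<Rightarrow>\<^sub>0 'f) set \<Rightarrow> bool" where
  "differential_submodule N \<longleftrightarrow> submodule N ring_of_type_algebra free_module \<and> D ` N \<subseteq> N"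

lemma differential_submodule_Z: "differential_submodule Z"
proof -
  have "differential_submodule (differential_submodule hull A)" for A
    by (rule hull_in) (auto simp: differential_submodule_def submodule_free_module_iff image_subset_iff)
  then show ?thesis
    by (simp only: dist_relations_def flip: differential_submodule_def)
qed

lemma Z_zero: "0 \<in> Z"
  and Z_add: "p \<in> Z \<Longrightarrow> q \<in> Z \<Longrightarrow> p + q \<in> Z"
  and Z_smult: "p \<in> Z \<Longrightarrow> f \<cdot> p \<in> Z"
  and Z_D: "p \<in> Z \<Longrightarrow> D p \<in> Z"
  using differential_submodule_Z
  by (auto simp: differential_submodule_def submodule_free_module_iff)

lemma Z_minus: "p \<in> Z \<Longrightarrow> - p \<in> Z"
proof -
  have "- p = (- 1) \<cdot> p" by (rule poly_mapping_eqI) simp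
  then show "p \<in> Z \<Longrightarrow> - p \<in> Z" by (simp only: Z_smult)
qed

lemma Z_diff: "p \<in> Z \<Longrightarrow> q \<in> Z \<Longrightarrow> p - q \<in> Z"
  using Z_add[OF _ Z_minus] by fastforce

text \<open>The generators with the coefficients collected at \<open>\<delta>\<^sub>a = H\<^sub>a'\<close>.\<close>
lemma Z_generator: "Poly_Mapping.single (DH a (Suc 0)) (f - ev a f) \<in> Z"
proof -
  have "f \<cdot> delta a - ev a f \<cdot> delta a \<in> Z"
    unfolding dist_relations_def by (rule hull_inc) blast
  then show ?thesis by (simp add: delta_def flip: single_diff)
qed

lemma Z_induct [consumes 1, case_names generator zero add smult D]:
  assumes "p \<in> Z"
    and generator: "\<And>a f. Q (Poly_Mapping.single (DH a (Suc 0)) (f - ev a f))"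
    and "Q 0" and "\<And>p q. Q p \<Longrightarrow> Q q \<Longrightarrow> Q (p + q)"
    and "\<And>f p. Q p \<Longrightarrow> Q (f \<cdot> p)" and "\<And>p. Q p \<Longrightarrow> Q (D p)"
  shows "Q p"
  using assms(1) unfolding dist_relations_def
proof (rule hull_induct)
  fix p assume "p \<in> (\<Union>f a. {f \<cdot> delta a - ev a f \<cdot> delta a})"
  then show "Q p" using generator by (auto simp: delta_def simp flip: single_diff)
qed (use assms(3-) in \<open>auto simp: submodule_free_module_iff\<close>)

text \<open>The bound on \<open>Z\<close> that keeps the piecewise extension intact in the quotient.\<close>
lemma Z_delta_supported: "p \<in> Z \<Longrightarrow> delta_supported p"
  by (induction p rule: Z_induct)
    (auto intro: delta_supported_zero delta_supported_add delta_supported_smult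
      delta_supported_single delta_supported_D)

text \<open>
  The factor \<open>g\<close> makes the property closed under module multiplication; closure under \<open>D\<close> comes
  from \<open>I (g D p) = g p - I (g' p)\<close>, which is integration by parts without boundary term.
\<close>
lemma I_smult_Z: "p \<in> Z \<Longrightarrow> I (g \<cdot> p) \<in> Z"
proof -
  assume "p \<in> Z"
  then have "p \<in> Z \<and> (\<forall>g. I (g \<cdot> p) \<in> Z)"
  proof (induction p rule: Z_induct)
    case (generator a f)
    show ?case by (simp add: Z_generator delta_integ_0 ev_mult ev_diff Z_zero)
  next
    case zero
    show ?case
      by (simp add: Z_zero additive.zero[OF additive_I]
          module.smult_r_null[OF module_free_module, simplified])
  next
    case (add p q)
    then show ?case by (simp add: Z_add smult_add_right additive.add[OF additive_I])
  next
    case (smult f p)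
    then show ?case by (simp add: Z_smult smult_smult)
  next
    case (D p)
    have "I (g \<cdot> D p) = g \<cdot> p - I (der g \<cdot> p)" for g
    proof -
      have "g \<cdot> D p = D (g \<cdot> p) - der g \<cdot> p" by (simp add: D_smult)
      then show ?thesis
        using D by (simp add: additive.diff[OF additive_I] I_D_delta_supported Z_smult Z_delta_supported)
    qed
    then show ?case using D by (simp add: Z_D Z_diff Z_smult)
  qed
  then show ?thesis by simp
qed

lemma I_Z: "p \<in> Z \<Longrightarrow> I p \<in> Z"
  using I_smult_Z[of p 1] module.smult_one[OF module_free_module, of p] by simp

lemma D_delta_integ: "D (delta_integ scale der integ S a k f) - Poly_Mapping.single (DH a (Suc k)) f \<in> Z"
proof (induction k arbitrary: f)
  case 0
  have "D (delta_integ scale der integ S a 0 f) - Poly_Mapping.single (DH a (Suc 0)) f =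
      - Poly_Mapping.single (DH a (Suc 0)) (f - ev a f)"
    by (simp add: delta_integ_0 additive.diff[OF additive_D] der_mult single_diff)
  then show ?case using Z_generator Z_minus by metis
next
  case (Suc k)
  have "D (delta_integ scale der integ S a (Suc k) f) - Poly_Mapping.single (DH a (Suc (Suc k))) f =
      - (D (delta_integ scale der integ S a k (der f)) - Poly_Mapping.single (DH a (Suc k)) (der f))"
    by (simp add: additive.diff[OF additive_D])
  then show ?case using Suc Z_minus by metis
qed

text \<open>
  The relations enter through \<open>D (\<integral>\<^sub>a f \<cdot> H\<^sub>a) = f H\<^sub>a + \<integral>\<^sub>a f \<cdot> \<delta>\<^sub>a\<close>, whose last term is in \<open>Z\<close>
  because \<open>e\<^sub>a\<close> kills \<open>\<integral>\<^sub>a f\<close>, and through \<open>D (I (f\<delta>\<^sub>a)) = e\<^sub>a(f)\<delta>\<^sub>a\<close>.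
\<close>
lemma D_I: "D (I p) - p \<in> Z"
proof (induction p rule: add_single_induct)
  case zero
  show ?case by (simp add: Z_zero additive.zero[OF additive_D] additive.zero[OF additive_I])
next
  case (add_single p b f)
  have "D (I (Poly_Mapping.single b f)) - Poly_Mapping.single b f \<in> Z"
  proof (cases b)
    case DUnit
    then show ?thesis by (simp add: der_integ Z_zero)
  next
    case (DH a k)
    show ?thesis
    proof (cases k)
      case 0
      then show ?thesis
        using DH Z_generator[of a "integ f"]
        by (simp add: additive.add[OF additive_D] der.diff der_integ der_mult)
    next
      case (Suc k')
      then show ?thesis using DH D_delta_integ by simp
    qed
  qed
  from Z_add[OF add_single.IH this] show ?case
    by (simp add: additive.add[OF additive_D] additive.add[OF additive_I] algebra_simps)
qed

text \<open>
  Up to \<open>Z\<close>, the subtracted sum is \<open>I (D (\<integral>f \<cdot> I p))\<close>, and \<open>\<integral>f \<cdot> I p\<close> is recovered from its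
  derivative because the factor \<open>\<integral>f\<close> vanishes at \<open>0\<close>.
\<close>
lemma rota_baxter_mod_Z: "integ f \<cdot> I p - (I (f \<cdot> I p) + I (integ f \<cdot> p)) \<in> Z"
proof -
  have defect: "integ f \<cdot> D (I p) = integ f \<cdot> p + integ f \<cdot> (D (I p) - p)"
    by (simp flip: smult_add_right)
  have "integ f \<cdot> I p = I (D (integ f \<cdot> I p))"
    by (rule I_D[symmetric]) (simp add: ev_mult)
  also have "\<dots> = I (f \<cdot> I p) + I (integ f \<cdot> p) + I (integ f \<cdot> (D (I p) - p))"
    by (simp only: D_smult der_integ defect additive.add[OF additive_I] add.assoc)
  finally show ?thesis using I_smult_Z[OF D_I] by simp
qed

lemma pw_to_free_in_Z: "pw_to_free p \<in> Z \<Longrightarrow> p = 0" for p :: "'k pw_gen \<Rightarrow>\<^sub>0 'f"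
proof (rule poly_mapping_eqI)
  fix b :: "'k pw_gen"
  assume "pw_to_free p \<in> Z"
  then have "delta_supported (pw_to_free p)" by (rule Z_delta_supported)
  then show "Poly_Mapping.lookup p b = Poly_Mapping.lookup 0 b"
    using lookup_pw_to_free[of p] by (cases b) (simp_all add: delta_supported_def)
qed

text \<open>Exact, since a congruence modulo \<open>Z\<close> between piecewise functions is an equation.\<close>
lemma P_rota_baxter: "integ f \<cdot> P p = P (f \<cdot> P p) + P (integ f \<cdot> p)"
proof -
  have "pw_to_free (integ f \<cdot> P p - (P (f \<cdot> P p) + P (integ f \<cdot> p))) \<in> Z"
    using rota_baxter_mod_Z[of f "pw_to_free p"]
    by (simp add: additive.diff[OF additive_pw_to_free] additive.add[OF additive_pw_to_free]
        pw_to_free_smult flip: I_pw_to_free)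
  then show ?thesis using pw_to_free_in_Z by fastforce
qed

section \<open>The distribution module\<close>

sublocale free: module_with_submodule ring_of_type_algebra
  "free_module :: ('f, 'k dist_gen \<Rightarrow>\<^sub>0 'f) module" Z
  using differential_submodule_Z
  by (simp add: module_with_submodule_def module_free_module differential_submodule_def)

abbreviation coset :: "('k dist_gen \<Rightarrow>\<^sub>0 'f) \<Rightarrow> ('k dist_gen \<Rightarrow>\<^sub>0 'f) set" where
  "coset \<equiv> dist_coset der integ S"

lemma coset_eq_iff: "coset p = coset q \<longleftrightarrow> p - q \<in> Z"
  by (simp add: dist_coset_def free.coset_eq_iff)

lemma dist_module_simps:
  "carrier (dist_module der integ S) = range coset"
  "coset p \<oplus>\<^bsub>dist_module der integ S\<^esub> coset q = coset (p + q)"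
  "f \<odot>\<^bsub>dist_module der integ S\<^esub> coset p = coset (f \<cdot> p)"
  using free.carrier_quot_module free.add_quot_module[of p q] free.smult_quot_module[of f p]
  by (simp_all add: dist_module_def dist_coset_def)

lemma linear_over_const_I: "linear_over (range (\<lambda>c. scale c 1)) free_module free_module I"
  by (auto simp: linear_over_def additive.add[OF additive_I] I_const_smult)

lemma linear_over_const_D: "linear_over (range (\<lambda>c. scale c 1)) free_module free_module D"
  by (auto simp: linear_over_def additive.add[OF additive_D] D_smult
      module.smult_l_null[OF module_free_module, simplified])

lemma dist_integ_coset: "dist_integ scale der integ S (coset p) = coset (I p)"
  using free.quot_map_linear_coset[OF linear_over_const_I, of p] I_Z
  by (auto simp: dist_integ_def dist_coset_def)

lemma dist_der_coset: "dist_der der integ S (coset p) = coset (D p)"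
  using free.quot_map_linear_coset[OF linear_over_const_D, of p] Z_D
  by (auto simp: dist_der_def dist_coset_def)

lemma free_integ_respects_congruence:
  "(\<lambda>p. coset (I p)) respects (racong\<^bsub>free_module\<^esub> Z)"
proof (rule congruentI)
  fix p q assume "(p, q) \<in> racong\<^bsub>free_module\<^esub> Z"
  then have "\<ominus>\<^bsub>free_module\<^esub> p \<oplus>\<^bsub>free_module\<^esub> q \<in> Z"
    by (simp add: a_r_congruent_def r_congruent_def a_inv_def)
  then have "- (- p + q) \<in> Z" by (intro Z_minus) simp
  then have "I (p - q) \<in> Z" by (simp add: I_Z)
  then show "coset (I p) = coset (I q)"
    by (simp add: coset_eq_iff additive.diff[OF additive_I])
qed

lemma dist_module_differential_rota_baxter:
  "differential_rota_baxter_module scale der integ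
     (dist_module der integ S) (dist_der der integ S) (dist_integ scale der integ S)"
proof -
  have "module ring_of_type_algebra (dist_module der integ S)"
    unfolding dist_module_def by (rule free.module_quot_module)
  moreover have "linear_over (range (\<lambda>c. scale c 1)) (dist_module der integ S) (dist_module der integ S)
      (dist_integ scale der integ S)"
    unfolding dist_module_def dist_integ_def
    by (rule free.linear_over_quot_map(2)[OF linear_over_const_I]) (use I_Z in auto)
  moreover have "linear_over (range (\<lambda>c. scale c 1)) (dist_module der integ S) (dist_module der integ S)
      (dist_der der integ S)"
    unfolding dist_module_def dist_der_def
    by (rule free.linear_over_quot_map(2)[OF linear_over_const_D]) (use Z_D in auto)
  ultimately show ?thesis
    by (intro differential_rota_baxter_module.intro rota_baxter_module.intro
        rota_baxter_module_axioms.intro differential_rota_baxter_module_axioms.intro)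
      (assumption | clarsimp simp: dist_module_simps dist_integ_coset dist_der_coset coset_eq_iff D_I
        rota_baxter_mod_Z D_smult Z_zero)+
qed

lemma pw_module_rota_baxter: "rota_baxter_module scale integ pw_module P"
  by (intro rota_baxter_module.intro rota_baxter_module_axioms.intro module_free_module)
    (auto simp: linear_over_def additive.add[OF additive_P] P_const_smult P_rota_baxter)

lemma dist_module_extends_pw_module:
  "rota_baxter_extension scale integ pw_module P
     (dist_module der integ S) (dist_integ scale der integ S) (pw_to_dist der integ S)"
proof (intro rota_baxter_extension.intro rota_baxter_extension_axioms.intro)
  show "inj_on (pw_to_dist der integ S) (carrier (pw_module :: ('f, 'k pw_gen \<Rightarrow>\<^sub>0 'f) module))"
  proof (rule inj_onI)
    fix p q :: "'k pw_gen \<Rightarrow>\<^sub>0 'f"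
    assume "pw_to_dist der integ S p = pw_to_dist der integ S q"
    then have "pw_to_free (p - q) \<in> Z"
      by (simp add: pw_to_dist_def coset_eq_iff additive.diff[OF additive_pw_to_free])
    then show "p = q" using pw_to_free_in_Z by fastforce
  qed
qed (use dist_module_differential_rota_baxter in
    \<open>auto simp: pw_module_rota_baxter differential_rota_baxter_module_def linear_over_def
      pw_to_dist_def dist_module_simps dist_integ_coset I_pw_to_free pw_to_free_smult
      additive.add[OF additive_pw_to_free]\<close>)

end

theorem theorem12:
  fixes scale :: "'k::linordered_field \<Rightarrow> 'f::comm_ring_1 \<Rightarrow> 'f"
    and der integ :: "'f \<Rightarrow> 'f"
    and S :: "'k \<Rightarrow> 'f \<Rightarrow> 'f"
  assumes "ordinary_integro_differential_algebra scale der integ"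
    and "shifted_integro_differential_algebra scale der integ S"
  shows "(\<lambda>\<phi>. dist_coset der integ S (free_integ scale der integ S \<phi>))
           respects (racong\<^bsub>free_module\<^esub> (dist_relations der integ S)) \<and>
         differential_rota_baxter_module scale der integ
           (dist_module der integ S) (dist_der der integ S) (dist_integ scale der integ S) \<and>
         rota_baxter_extension scale integ
           pw_module (pw_integ scale der integ S)
           (dist_module der integ S) (dist_integ scale der integ S)
           (pw_to_dist der integ S)"
proof -
  interpret ordinary_shifted_integro_differential_algebra scale der integ S
    using assms by (rule ordinary_shifted_integro_differential_algebra.intro)
  show ?thesis
    using free_integ_respects_congruence dist_module_differential_rota_baxter
      dist_module_extends_pw_module by blast
qed

end
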